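(* Let $X$ be a Banach lattice. The following are equivalent: (i) $X$ is $\sigma$-Levi, i.e. every norm bounded increasing sequence in $X_+$ has a supremum in $X$; (ii) $X$ is sequentially boundedly $uo$-complete, i.e. every norm bounded $uo$-Cauchy sequence in $X$ is $uo$-convergent in $X$; (iii) every increasing norm bounded $uo$-Cauchy sequence in $X_+$ has a supremum in $X$.
   Context: A net $(x_\alpha)$ in a vector lattice $X$ converges in order to $x$, written $x_\alpha\xrightarrow{o}x$, if there is a net $(y_\beta)$ in $X$, possibly over a different index set, with $y_\beta\downarrow 0$ and such that for every $\beta$ there is $\alpha_0$ with $|x_\alpha-x|\le y_\beta$ whenever $\alpha\ge\alpha_0$. A net $(x_\alpha)$ $uo$-converges to $x\in X$, written $x_\alpha\xrightarrow{uo}x$, if $|x_\alpha-x|\wedge u\xrightarrow{o}0$ for every $u\in X_+$. A net $(x_\alpha)$ is $uo$-Cauchy if the doubly indexed net $(x_\alpha-x_{\alpha'})_{(\alpha,\alpha')}$ $uo$-converges to $0$. These notions apply to sequences viewed as nets. The $\sigma$-Levi property is also called sequential monotone completeness. *)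

theory Defs
  imports
    "HOL-Analysis.Analysis"
    "HOL-Library.Lattice_Algebras"
    "HOL-Library.Lub_Glb"
    "HOL-Library.Product_Order"
begin

text \<open>
  The lattice operations are \<^const>\<open>inf\<close> and \<^const>\<open>sup\<close>; the class
  \<^class>\<open>lattice_ab_group_add_abs\<close> fixes the modulus as the supremum of \<open>x\<close> and \<open>- x\<close>.
\<close>

class banach_lattice = banach + ordered_real_vector + lattice_ab_group_add_abs +
  assumes norm_lattice_mono: "\<bar>x\<bar> \<le> \<bar>y\<bar> \<Longrightarrow> norm x \<le> norm y"

instance real :: banach_lattice
  by standard simp

definition directed_index :: "'j set \<Rightarrow> ('j \<Rightarrow> 'j \<Rightarrow> bool) \<Rightarrow> bool" where
  "directed_index J le \<longleftrightarrow>
     J \<noteq> {} \<and> reflp_on J le \<and> transp_on J le \<and> (\<forall>i\<in>J. \<forall>j\<in>J. \<exists>k\<in>J. le i k \<and> le j k)"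

definition net_decreases_to :: "'j set \<Rightarrow> ('j \<Rightarrow> 'j \<Rightarrow> bool) \<Rightarrow> ('j \<Rightarrow> 'a::order) \<Rightarrow> 'a \<Rightarrow> bool" where
  "net_decreases_to J le y a \<longleftrightarrow>
     directed_index J le \<and> (\<forall>i\<in>J. \<forall>j\<in>J. le i j \<longrightarrow> y j \<le> y i) \<and> isGlb UNIV (y ` J) a"

text \<open>
  The net \<open>x\<close> is indexed by a (directed) preordered type, with the product order for doubly indexed
  nets. The dominating net \<open>y\<close> has its own index set, a preordered subset of \<open>'a\<close>. Since HOL cannot
  quantify existentially over index types, the carrier type \<open>'a\<close> is fixed here; the lemma
  \<open>order_convI\<close> below shows that index sets in an arbitrary type give the same notion.
\<close>

definition order_conv :: "('i::preorder \<Rightarrow> 'a::banach_lattice) \<Rightarrow> 'a \<Rightarrow> bool" where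
  "order_conv x l \<longleftrightarrow>
     (\<exists>(J :: 'a set) le y. net_decreases_to J le y 0 \<and>
        (\<forall>b\<in>J. \<exists>a0. \<forall>a. a0 \<le> a \<longrightarrow> \<bar>x a - l\<bar> \<le> y b))"

lemma order_convI:
  fixes x :: "'i::preorder \<Rightarrow> 'a::banach_lattice" and J :: "'j set"
  assumes "net_decreases_to J le y 0"
    and "\<forall>b\<in>J. \<exists>a0. \<forall>a. a0 \<le> a \<longrightarrow> \<bar>x a - l\<bar> \<le> y b"
  shows "order_conv x l"
proof -
  have "J \<noteq> {}" and dir: "\<And>i j. i \<in> J \<Longrightarrow> j \<in> J \<Longrightarrow> \<exists>k\<in>J. le i k \<and> le j k"
    and dec: "\<And>i j. i \<in> J \<Longrightarrow> j \<in> J \<Longrightarrow> le i j \<Longrightarrow> y j \<le> y i" and glb: "isGlb UNIV (y ` J) 0"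
    using assms(1) unfolding net_decreases_to_def directed_index_def by auto
  have "\<exists>k\<in>J. y k \<le> y i \<and> y k \<le> y j" if "i \<in> J" "j \<in> J" for i j
    using dir[OF that] dec that by blast
  then have "directed_index (y ` J) (\<lambda>a b. b \<le> a)"
    using \<open>J \<noteq> {}\<close> unfolding directed_index_def
    by (auto simp: reflp_on_def transp_on_def)
  then have "net_decreases_to (y ` J) (\<lambda>a b. b \<le> a) (\<lambda>a. a) 0"
    using glb unfolding net_decreases_to_def by simp
  moreover have "\<forall>b\<in>y ` J. \<exists>a0. \<forall>a. a0 \<le> a \<longrightarrow> \<bar>x a - l\<bar> \<le> b"
    using assms(2) by blast
  ultimately show ?thesis
    unfolding order_conv_def by blast
qed

definition uo_conv :: "('i::preorder \<Rightarrow> 'a::banach_lattice) \<Rightarrow> 'a \<Rightarrow> bool" where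
  "uo_conv x l \<longleftrightarrow> (\<forall>u\<ge>0. order_conv (\<lambda>a. inf \<bar>x a - l\<bar> u) 0)"

definition uo_Cauchy :: "('i::preorder \<Rightarrow> 'a::banach_lattice) \<Rightarrow> bool" where
  "uo_Cauchy x \<longleftrightarrow> uo_conv (\<lambda>(a, b). x a - x b) 0"

text \<open>The following properties of the space are predicates on its type, as in \<open>sigma_Levi TYPE('a)\<close>.\<close>

definition sigma_Levi :: "'a::banach_lattice itself \<Rightarrow> bool" where
  "sigma_Levi _ \<longleftrightarrow>
     (\<forall>x :: nat \<Rightarrow> 'a. (\<forall>n. 0 \<le> x n) \<and> incseq x \<and> bounded (range x) \<longrightarrow>
        (\<exists>s. isLub UNIV (range x) s))"

definition sequentially_boundedly_uo_complete :: "'a::banach_lattice itself \<Rightarrow> bool" where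
  "sequentially_boundedly_uo_complete _ \<longleftrightarrow>
     (\<forall>x :: nat \<Rightarrow> 'a. bounded (range x) \<and> uo_Cauchy x \<longrightarrow> (\<exists>l. uo_conv x l))"

end

theory Submission
  imports Defs
begin

text \<open>
  (i) implies (ii). Passing to positive and negative parts, let \<open>x\<close> be a norm bounded uo-Cauchy
  sequence of positive elements. In a \<open>\<sigma>\<close>-Levi space every sequence of positive elements has an
  infimum, so \<open>w k = inf {x n | n \<ge> k}\<close> exists. It increases and is dominated by \<open>x k\<close>, hence is norm
  bounded and has a supremum \<open>l\<close>, the lower limit of \<open>x\<close>. By the infinite distributive law any
  bound \<open>inf \<bar>x m - x n\<bar> u \<le> y\<close> that holds on a tail passes to \<open>inf \<bar>x n - l\<bar> u \<le> y\<close>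
  (\<open>sigma_Levi_liminf\<close>), so \<open>x\<close> uo-converges to \<open>l\<close>.

  (ii) implies (iii), because a uo-limit of an increasing sequence is its supremum
  (\<open>incseq_uo_conv_isLub\<close>).

  (iii) implies (i). It is enough that a norm bounded increasing sequence \<open>x\<close> of positive elements
  is uo-Cauchy. Say that \<open>x\<close> exhausts \<open>w \<ge> 0\<close> if \<open>inf (x m) (k w)\<close> increases to \<open>k w\<close> for every
  natural number \<open>k\<close>. An Archimedean argument shows that an increasing sequence of positive elements
  which exhausts only \<open>0\<close> is uo-Cauchy (\<open>uo_CauchyI_exhausts\<close>). Suppose that \<open>x\<close> exhausts some
  \<open>y \<noteq> 0\<close>. The norm bound allows \<open>y\<close> to be rescaled so that \<open>p m = (y - x m)\<^sup>+\<close> is nonzero for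
  every \<open>m\<close>. Let \<open>f j\<close> be the sum of \<open>m p m / \<parallel>p m\<parallel>\<close> over \<open>m \<le> j\<close>, so that \<open>\<parallel>f j\<parallel> \<ge> j\<close>. The
  sequence \<open>z m = inf (x m) (f m)\<close> is increasing and norm bounded. It exhausts only \<open>0\<close>, since the
  bands generated by the \<open>p m\<close> decrease to \<open>{0}\<close> (\<open>exhausts_inf_partial_sums\<close>); hence it is
  uo-Cauchy, and by (iii) it has a supremum \<open>s\<close>. As \<open>f j\<close> lies below a multiple of \<open>y\<close>, which \<open>x\<close>
  exhausts, \<open>f j\<close> is the supremum of \<open>inf (x m) (f j)\<close> over \<open>m\<close>, so \<open>f j \<le> s\<close> for all \<open>j\<close>. This
  contradicts \<open>\<parallel>f j\<parallel> \<ge> j\<close>.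
\<close>

section \<open>Inequalities in vector lattices\<close>

lemma isLub_range_iff:
  fixes x :: "'i \<Rightarrow> 'a::order"
  shows "isLub UNIV (range x) s \<longleftrightarrow> (\<forall>n. x n \<le> s) \<and> (\<forall>b. (\<forall>n. x n \<le> b) \<longrightarrow> s \<le> b)"
  by (auto simp: isLub_def leastP_def isUb_def setle_def setge_def)

lemma isGlb_image_iff:
  fixes y :: "'i \<Rightarrow> 'a::order"
  shows "isGlb UNIV (y ` J) g \<longleftrightarrow> (\<forall>j\<in>J. g \<le> y j) \<and> (\<forall>w. (\<forall>j\<in>J. w \<le> y j) \<longrightarrow> w \<le> g)"
  by (auto simp: isGlb_def greatestP_def isLb_def setle_def setge_def)

lemma net_decreases_to_leD: "net_decreases_to J le y a \<Longrightarrow> j \<in> J \<Longrightarrow> a \<le> y j"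
  by (simp add: net_decreases_to_def isGlb_image_iff)

lemma net_decreases_to_greatestD:
  assumes "net_decreases_to J le y a" "\<And>j. j \<in> J \<Longrightarrow> w \<le> y j"
  shows "w \<le> a"
  using assms by (simp add: net_decreases_to_def isGlb_image_iff)

lemma abs_le_lattice_iff:
  fixes a :: "'a::lattice_ab_group_add_abs"
  shows "\<bar>a\<bar> \<le> b \<longleftrightarrow> a \<le> b \<and> - a \<le> b"
  by (simp add: abs_lattice)

text \<open>
  Since \<open>\<bar>t\<bar>\<close> is the supremum of \<open>t\<close> and \<open>- t\<close>, this is an instance of the distributive law, which
  holds in every lattice ordered group.
\<close>

lemma inf_abs_le_iff:
  fixes t :: "'a::lattice_ab_group_add_abs"
  shows "inf \<bar>t\<bar> u \<le> y \<longleftrightarrow> inf t u \<le> y \<and> inf (- t) u \<le> y"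
proof
  assume "inf \<bar>t\<bar> u \<le> y"
  then show "inf t u \<le> y \<and> inf (- t) u \<le> y"
    by (meson abs_ge_self abs_ge_minus_self inf_mono order_refl order_trans)
next
  assume le: "inf t u \<le> y \<and> inf (- t) u \<le> y"
  define c where "c = inf \<bar>t\<bar> u"
  have *: "c - (\<bar>t\<bar> - s) \<le> inf s u" if "s \<le> \<bar>t\<bar>" for s
  proof -
    have "c - (\<bar>t\<bar> - s) \<le> \<bar>t\<bar> - (\<bar>t\<bar> - s)"
      unfolding c_def by (intro diff_right_mono) simp
    moreover have "c - (\<bar>t\<bar> - s) \<le> u - 0"
      using that unfolding c_def by (intro diff_mono) simp_all
    ultimately show ?thesis by simp
  qed
  have "c - (\<bar>t\<bar> - t) \<le> y" "c - (\<bar>t\<bar> - - t) \<le> y"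
    using order_trans[OF *[of t]] order_trans[OF *[of "- t"]] le
    by (simp_all add: abs_ge_self abs_ge_minus_self)
  then have "t \<le> y - c + \<bar>t\<bar>" "- t \<le> y - c + \<bar>t\<bar>"
    by (simp_all add: algebra_simps)
  then have "\<bar>t\<bar> \<le> y - c + \<bar>t\<bar>"
    by (simp only: abs_le_lattice_iff)
  then have "c \<le> y" by simp
  then show "inf \<bar>t\<bar> u \<le> y" by (simp only: c_def)
qed

lemma inf_le_inf_add_diff:
  fixes t :: "'a::lattice_ab_group_add"
  assumes "w \<le> u"
  shows "inf t u \<le> inf t w + (u - w)"
proof -
  have "inf t u \<le> t + (u - w)"
    using assms by (intro le_infI1) simp
  then show ?thesis
    by (simp add: add_inf_distrib_right)
qed

lemma inf_add_le:
  fixes a :: "'a::lattice_ab_group_add"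
  assumes "0 \<le> a" "0 \<le> b" "0 \<le> c"
  shows "inf (a + b) c \<le> inf a c + inf b c"
proof -
  have "inf a c + inf b c = inf (inf (a + b) (a + c)) (inf (c + b) (c + c))"
    by (simp add: add_inf_distrib_left add_inf_distrib_right inf_assoc inf_left_commute)
  moreover have "c \<le> a + c" "c \<le> c + b" "c \<le> c + c"
    using assms by simp_all
  ultimately show ?thesis
    by (auto intro: le_infI2)
qed

lemma inf_pos_neg_parts:
  fixes t :: "'a::lattice_ab_group_add"
  shows "inf (sup t 0) (sup (- t) 0) = 0"
proof -
  have "sup (- t) 0 = - t + sup t 0"
    by (simp add: add_sup_distrib_left sup_commute)
  then have "inf (sup t 0) (sup (- t) 0) = sup t 0 + inf 0 (- t)"
    by (simp add: add_inf_distrib_left add.commute)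
  also have "\<dots> = 0"
    by (metis inf_commute nprt_neg pprt_def nprt_def add.right_inverse)
  finally show ?thesis .
qed

lemma abs_pos_part_diff_le:
  fixes a :: "'a::lattice_ab_group_add_abs"
  shows "\<bar>sup a 0 - sup b 0\<bar> \<le> \<bar>a - b\<bar>"
proof -
  have *: "sup a 0 - sup b 0 \<le> \<bar>a - b\<bar>" for a b :: 'a
  proof -
    have "a \<le> b + \<bar>a - b\<bar>"
      using abs_ge_self[of "a - b"] by (simp add: algebra_simps)
    then have "a \<le> \<bar>a - b\<bar> + sup b 0"
      by (metis add.commute add_left_mono order_trans sup_ge1)
    moreover have "0 \<le> \<bar>a - b\<bar> + sup b 0" by simp
    ultimately have "sup a 0 \<le> \<bar>a - b\<bar> + sup b 0" by (rule sup_least)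
    then show ?thesis by (simp only: diff_le_eq)
  qed
  have "- (sup a 0 - sup b 0) \<le> \<bar>a - b\<bar>"
    using *[of b a] by (simp only: minus_diff_eq abs_minus_commute)
  with * show ?thesis
    by (simp only: abs_le_lattice_iff)
qed

lemma inf_scaleR_eq_zero:
  fixes a :: "'a::banach_lattice"
  assumes "0 \<le> a" "0 \<le> b" "inf a b = 0" "0 \<le> r" "0 \<le> s"
  shows "inf (r *\<^sub>R a) (s *\<^sub>R b) = 0"
proof -
  define K where "K = r + s + 1"
  have K: "0 < K" "r \<le> K" "s \<le> K" using assms by (simp_all add: K_def)
  have "inf (r *\<^sub>R a) (s *\<^sub>R b) \<le> K *\<^sub>R a" "inf (r *\<^sub>R a) (s *\<^sub>R b) \<le> K *\<^sub>R b"
    using K assms by (meson inf_le1 inf_le2 order_trans scaleR_right_mono)+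
  then have "inf (r *\<^sub>R a) (s *\<^sub>R b) /\<^sub>R K \<le> inf a b"
    using K by (simp add: pos_divideR_le_eq)
  then have "inf (r *\<^sub>R a) (s *\<^sub>R b) \<le> 0"
    using K assms by (simp add: pos_divideR_le_eq)
  then show ?thesis
    using assms by (intro antisym) (simp_all add: scaleR_nonneg_nonneg)
qed

lemma norm_mono_nonneg:
  fixes a :: "'a::banach_lattice"
  shows "0 \<le> a \<Longrightarrow> a \<le> b \<Longrightarrow> norm a \<le> norm b"
  by (rule norm_lattice_mono) (simp add: abs_of_nonneg)

text \<open>A Banach lattice is Archimedean.\<close>

lemma archimedean_le_zero:
  fixes a b :: "'a::banach_lattice"
  assumes "\<And>k::nat. real k *\<^sub>R a \<le> b"
  shows "a \<le> 0"
proof -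
  have "real k * norm (sup a 0) \<le> norm (sup b 0)" for k :: nat
  proof (cases "k = 0")
    case False
    have "a \<le> sup b 0 /\<^sub>R real k"
      using assms[of k] False by (simp add: pos_le_divideR_eq le_supI1)
    moreover have "0 \<le> sup b 0 /\<^sub>R real k"
      by (simp add: scaleR_nonneg_nonneg)
    ultimately have "norm (sup a 0) \<le> norm (sup b 0 /\<^sub>R real k)"
      by (intro norm_mono_nonneg) simp_all
    then show ?thesis using False by (simp add: field_simps)
  qed simp
  then have "norm (sup a 0) \<le> 0"
    using reals_Archimedean3[of "norm (sup a 0)"] by (meson not_le)
  then have "sup a 0 = 0" by simp
  then show ?thesis by (metis sup_ge1)
qed

section \<open>Unbounded order convergence of sequences\<close>

lemma uo_CauchyD:
  fixes x :: "nat \<Rightarrow> 'a::banach_lattice"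
  assumes "uo_Cauchy x" "0 \<le> u"
  obtains J :: "'a set" and le y where "net_decreases_to J le y 0"
    "\<And>b. b \<in> J \<Longrightarrow> \<exists>n0. \<forall>m\<ge>n0. \<forall>n\<ge>n0. inf \<bar>x m - x n\<bar> u \<le> y b"
proof -
  have "order_conv (\<lambda>p. inf \<bar>(case p of (a, b) \<Rightarrow> x a - x b) - 0\<bar> u) 0"
    using assms unfolding uo_Cauchy_def uo_conv_def by blast
  then obtain J :: "'a set" and le y where net: "net_decreases_to J le y 0"
    and dom: "\<forall>b\<in>J. \<exists>a0. \<forall>a\<ge>a0. \<bar>inf \<bar>(case a of (m, n) \<Rightarrow> x m - x n) - 0\<bar> u - 0\<bar> \<le> y b"
    unfolding order_conv_def by blast
  have "\<exists>n0. \<forall>m\<ge>n0. \<forall>n\<ge>n0. inf \<bar>x m - x n\<bar> u \<le> y b" if b: "b \<in> J" for b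
  proof -
    obtain i j where ij: "\<And>a. (i, j) \<le> a \<Longrightarrow>
        \<bar>inf \<bar>(case a of (m, n) \<Rightarrow> x m - x n) - 0\<bar> u - 0\<bar> \<le> y b"
      using dom b by (metis surj_pair)
    have "inf \<bar>x m - x n\<bar> u \<le> y b" if "m \<ge> max i j" "n \<ge> max i j" for m n
      using ij[of "(m, n)"] that assms(2) by (simp add: abs_of_nonneg)
    then show ?thesis by blast
  qed
  with net show thesis using that by blast
qed

lemma uo_conv_sequenceD:
  fixes x :: "nat \<Rightarrow> 'a::banach_lattice"
  assumes "uo_conv x l" "0 \<le> u" "\<And>n. n \<ge> n0 \<Longrightarrow> w \<le> inf \<bar>x n - l\<bar> u"
  shows "w \<le> 0"
proof -
  have "order_conv (\<lambda>n. inf \<bar>x n - l\<bar> u) 0"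
    using assms unfolding uo_conv_def by blast
  then obtain J :: "'a set" and le y where net: "net_decreases_to J le y 0"
    and dom: "\<forall>b\<in>J. \<exists>a0. \<forall>a\<ge>a0. \<bar>inf \<bar>x a - l\<bar> u - 0\<bar> \<le> y b"
    unfolding order_conv_def by blast
  have "w \<le> y b" if b: "b \<in> J" for b
  proof -
    obtain a0 where "\<And>a. a \<ge> a0 \<Longrightarrow> inf \<bar>x a - l\<bar> u \<le> y b"
      using dom b assms(2) by (fastforce simp: abs_of_nonneg)
    then show ?thesis
      using assms(3)[of "max n0 a0"] by (meson max.cobounded1 max.cobounded2 order_trans)
  qed
  then show ?thesis using net by (rule net_decreases_to_greatestD[rotated])
qed

lemma incseq_uo_conv_isLub:
  fixes x :: "nat \<Rightarrow> 'a::banach_lattice"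
  assumes inc: "incseq x" and conv: "uo_conv x l"
  shows "isLub UNIV (range x) l"
  unfolding isLub_range_iff
proof (intro conjI allI impI)
  fix m
  have "sup (x m - l) 0 \<le> inf \<bar>x n - l\<bar> (sup (x m - l) 0)" if "n \<ge> m" for n
  proof -
    have "x m - l \<le> \<bar>x n - l\<bar>"
      using incseqD[OF inc that] abs_ge_self[of "x n - l"] by (meson diff_right_mono order_trans)
    then show ?thesis by simp
  qed
  then have "sup (x m - l) 0 \<le> 0"
    by (rule uo_conv_sequenceD[OF conv, rotated]) simp_all
  then show "x m \<le> l" by simp
next
  fix b assume b: "\<forall>n. x n \<le> b"
  have "sup (l - b) 0 \<le> inf \<bar>x n - l\<bar> (sup (l - b) 0)" if "n \<ge> 0" for n
  proof -
    have "l - b \<le> l - x n" using b by (simp add: diff_left_mono)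
    also have "\<dots> \<le> \<bar>x n - l\<bar>" using abs_ge_minus_self[of "x n - l"] by simp
    finally show ?thesis by simp
  qed
  then have "sup (l - b) 0 \<le> 0"
    by (rule uo_conv_sequenceD[OF conv, rotated]) simp_all
  then show "l \<le> b" by simp
qed

section \<open>Lower limits in \<open>\<sigma>\<close>-Levi spaces\<close>

text \<open>
  The infinite distributive law: if \<open>g\<close> is the infimum of the \<open>a i\<close>, then \<open>inf (z - g) u\<close> is the
  supremum of the elements \<open>inf (z - a i) u\<close>.
\<close>

lemma inf_diff_Inf_le:
  fixes g :: "'a::lattice_ab_group_add"
  assumes greatest: "\<And>c. (\<And>i. i \<in> I \<Longrightarrow> c \<le> a i) \<Longrightarrow> c \<le> g"
    and lower: "\<And>i. i \<in> I \<Longrightarrow> g \<le> a i"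
    and le: "\<And>i. i \<in> I \<Longrightarrow> inf (z - a i) u \<le> y"
  shows "inf (z - g) u \<le> y"
proof -
  have "inf (z - g) u - y + g \<le> a i" if i: "i \<in> I" for i
  proof -
    have "inf (z - g) u - (a i - g) \<le> z - g - (a i - g)"
      by (intro diff_right_mono) simp
    moreover have "inf (z - g) u - (a i - g) \<le> u - 0"
      using lower[OF i] by (intro diff_mono) simp_all
    ultimately have "inf (z - g) u - (a i - g) \<le> inf (z - a i) u"
      by simp
    with le[OF i] have "inf (z - g) u - (a i - g) \<le> y"
      by (rule order_trans[rotated])
    then show ?thesis by (simp add: algebra_simps)
  qed
  then have "inf (z - g) u - y + g \<le> g"
    by (rule greatest)
  then show ?thesis by simp
qed

lemma inf_abs_diff_Inf_le:
  fixes g :: "'a::lattice_ab_group_add_abs"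
  assumes greatest: "\<And>c. (\<And>i. i \<in> I \<Longrightarrow> c \<le> a i) \<Longrightarrow> c \<le> g"
    and lower: "\<And>i. i \<in> I \<Longrightarrow> g \<le> a i"
    and le: "\<And>i. i \<in> I \<Longrightarrow> inf \<bar>z - a i\<bar> u \<le> y" and "j \<in> I"
  shows "inf \<bar>z - g\<bar> u \<le> y"
  unfolding inf_abs_le_iff
proof
  have le': "inf (z - a i) u \<le> y" if "i \<in> I" for i
    using le[OF that] by (simp only: inf_abs_le_iff)
  show "inf (z - g) u \<le> y"
    by (rule inf_diff_Inf_le[OF greatest lower le'])
  have "inf (- (z - g)) u \<le> inf (- (z - a j)) u"
    using lower[OF \<open>j \<in> I\<close>] by (intro inf_mono) simp_all
  also have "\<dots> \<le> y"
    using le[OF \<open>j \<in> I\<close>] by (simp only: inf_abs_le_iff)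
  finally show "inf (- (z - g)) u \<le> y" .
qed

lemma inf_abs_diff_Sup_le:
  fixes g :: "'a::lattice_ab_group_add_abs"
  assumes least: "\<And>c. (\<And>i. i \<in> I \<Longrightarrow> a i \<le> c) \<Longrightarrow> g \<le> c"
    and upper: "\<And>i. i \<in> I \<Longrightarrow> a i \<le> g"
    and le: "\<And>i. i \<in> I \<Longrightarrow> inf \<bar>z - a i\<bar> u \<le> y" and "j \<in> I"
  shows "inf \<bar>z - g\<bar> u \<le> y"
proof -
  have "inf \<bar>- z - (- g)\<bar> u \<le> y"
  proof (rule inf_abs_diff_Inf_le[where a = "\<lambda>i. - a i" and I = I])
    fix c assume "\<And>i. i \<in> I \<Longrightarrow> c \<le> - a i"
    then have "g \<le> - c" by (intro least) (simp add: le_minus_iff)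
    then show "c \<le> - g" by (simp add: le_minus_iff)
  next
    fix i assume i: "i \<in> I"
    show "- g \<le> - a i" using upper[OF i] by simp
    show "inf \<bar>- z - - a i\<bar> u \<le> y"
      using le[OF i] by (simp add: abs_minus_commute)
  qed fact
  then show ?thesis by (simp add: abs_minus_commute)
qed

lemma sigma_LeviE:
  fixes x :: "nat \<Rightarrow> 'a::banach_lattice"
  assumes "sigma_Levi TYPE('a)" "\<And>n. 0 \<le> x n" "incseq x" "bounded (range x)"
  obtains s where "\<And>n. x n \<le> s" "\<And>b. (\<And>n. x n \<le> b) \<Longrightarrow> s \<le> b"
proof -
  have "\<exists>s. isLub UNIV (range x) s"
    using assms unfolding sigma_Levi_def by blast
  then show thesis
    using that unfolding isLub_range_iff by blast
qed

lemma sigma_Levi_Inf_exists: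
  fixes x :: "nat \<Rightarrow> 'a::banach_lattice"
  assumes levi: "sigma_Levi TYPE('a)" and pos: "\<And>n. 0 \<le> x n"
  obtains g where "\<And>n. g \<le> x n" "\<And>c. (\<And>n. c \<le> x n) \<Longrightarrow> c \<le> g"
proof -
  define v where "v = rec_nat (x 0) (\<lambda>n a. inf a (x (Suc n)))"
  have v_rec: "v 0 = x 0" "v (Suc n) = inf (v n) (x (Suc n))" for n
    by (simp_all add: v_def)
  have v_le: "v n \<le> x n" for n
    by (cases n) (simp_all add: v_rec)
  have v_pos: "0 \<le> v n" for n
    by (induction n) (simp_all add: v_rec pos)
  have "antimono v"
    by (rule decseq_SucI) (simp add: v_rec)
  then have v_le0: "v n \<le> x 0" for n
    using decseqD[of v 0 n] by (simp add: v_rec)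
  have v_greatest: "c \<le> v n" if "\<And>n. c \<le> x n" for c n
    by (induction n) (simp_all add: v_rec that)
  have "norm (x 0 - v n) \<le> norm (x 0)" for n
    using v_le0[of n] v_pos[of n] by (intro norm_mono_nonneg) simp_all
  then have v_bdd: "bounded (range (\<lambda>n. x 0 - v n))"
    by (auto simp: bounded_iff)
  have v_inc: "incseq (\<lambda>n. x 0 - v n)"
    using \<open>antimono v\<close> by (auto simp: incseq_def decseq_def intro: diff_left_mono)
  have "0 \<le> x 0 - v n" for n
    using v_le0 by simp
  then obtain s where s: "\<And>n. x 0 - v n \<le> s" "\<And>b. (\<And>n. x 0 - v n \<le> b) \<Longrightarrow> s \<le> b"
    using sigma_LeviE[OF levi _ v_inc v_bdd] by metis
  show thesis
  proof
    show "x 0 - s \<le> x n" for n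
    proof -
      have "x 0 - s \<le> v n"
        using s(1)[of n] by (simp add: algebra_simps)
      then show ?thesis using v_le[of n] by (rule order_trans)
    qed
  next
    fix c assume "\<And>n. c \<le> x n"
    then have "c \<le> v n" for n by (rule v_greatest)
    then have "s \<le> x 0 - c"
      by (intro s(2) diff_left_mono)
    then show "c \<le> x 0 - s" by (simp add: algebra_simps)
  qed
qed

text \<open>
  The witness is the lower limit \<open>l\<close> of \<open>x\<close>: every uniform bound for the truncated differences
  \<open>inf \<bar>x m - x n\<bar> u\<close> of a tail passes to \<open>inf \<bar>x n - l\<bar> u\<close>.
\<close>

lemma sigma_Levi_liminf:
  fixes x :: "nat \<Rightarrow> 'a::banach_lattice"
  assumes levi: "sigma_Levi TYPE('a)" and pos: "\<And>n. 0 \<le> x n" and bdd: "bounded (range x)"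
  obtains l where "\<And>u y n0. \<forall>m\<ge>n0. \<forall>n\<ge>n0. inf \<bar>x m - x n\<bar> u \<le> y \<Longrightarrow>
      \<forall>n\<ge>n0. inf \<bar>x n - l\<bar> u \<le> y"
proof -
  have "\<exists>g. (\<forall>n\<ge>k. g \<le> x n) \<and> (\<forall>c. (\<forall>n\<ge>k. c \<le> x n) \<longrightarrow> c \<le> g)" for k
  proof -
    obtain g where "\<And>n. g \<le> x (n + k)" "\<And>c. (\<And>n. c \<le> x (n + k)) \<Longrightarrow> c \<le> g"
      using sigma_Levi_Inf_exists[OF levi, of "\<lambda>n. x (n + k)"] pos by blast
    then show ?thesis by (metis le_add2 le_add_diff_inverse2)
  qed
  then obtain w where w_le: "\<And>k n. n \<ge> k \<Longrightarrow> w k \<le> x n"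
    and w_greatest: "\<And>k c. (\<And>n. n \<ge> k \<Longrightarrow> c \<le> x n) \<Longrightarrow> c \<le> w k"
    by metis
  have w_pos: "0 \<le> w k" for k
    by (rule w_greatest) (rule pos)
  have w_inc: "incseq w"
    by (rule incseq_SucI) (auto intro!: w_greatest w_le)
  obtain M where "\<And>n. norm (x n) \<le> M"
    using bdd by (auto simp: bounded_iff)
  then have "norm (w k) \<le> M" for k
    using norm_mono_nonneg[OF w_pos w_le[OF order_refl], of k] order_trans by blast
  then have "bounded (range w)"
    by (auto simp: bounded_iff)
  then obtain l where l: "\<And>k. w k \<le> l" "\<And>b. (\<And>k. w k \<le> b) \<Longrightarrow> l \<le> b"
    using sigma_LeviE[OF levi w_pos w_inc] by metis
  show thesis
  proof (rule that, intro allI impI)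
    fix u y :: 'a and n0 n :: nat
    assume le: "\<forall>m\<ge>n0. \<forall>n\<ge>n0. inf \<bar>x m - x n\<bar> u \<le> y" and n: "n \<ge> n0"
    have w: "inf \<bar>x n - w k\<bar> u \<le> y" if "k \<ge> n0" for k
      by (rule inf_abs_diff_Inf_le[where a = x and I = "{k..}" and j = k])
        (use that n le in \<open>auto intro!: w_greatest w_le\<close>)
    show "inf \<bar>x n - l\<bar> u \<le> y"
    proof (rule inf_abs_diff_Sup_le[where a = w and I = "{n0..}" and j = n0])
      fix c assume c: "\<And>k. k \<in> {n0..} \<Longrightarrow> w k \<le> c"
      have "w k \<le> c" for k
        using incseqD[OF w_inc max.cobounded1[of k n0]] c[of "max k n0"] by simp
      then show "l \<le> c" by (rule l(2))
    qed (use w l in auto)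
  qed
qed

lemma sigma_Levi_imp_uo_complete:
  assumes levi: "sigma_Levi TYPE('a::banach_lattice)"
  shows "sequentially_boundedly_uo_complete TYPE('a)"
  unfolding sequentially_boundedly_uo_complete_def
proof (intro allI impI)
  fix x :: "nat \<Rightarrow> 'a"
  assume x: "bounded (range x) \<and> uo_Cauchy x"
  then obtain M where M: "\<And>n. norm (x n) \<le> M"
    by (auto simp: bounded_iff)
  have "norm (sup (x n) 0) \<le> M" "norm (sup (- x n) 0) \<le> M" for n
  proof -
    have "norm (sup (x n) 0) \<le> norm (x n)" "norm (sup (- x n) 0) \<le> norm (x n)"
      by (intro norm_lattice_mono; simp add: abs_of_nonneg abs_ge_self abs_ge_minus_self)+
    then show "norm (sup (x n) 0) \<le> M" "norm (sup (- x n) 0) \<le> M"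
      using M[of n] by simp_all
  qed
  then have bdd: "bounded (range (\<lambda>n. sup (x n) 0))" "bounded (range (\<lambda>n. sup (- x n) 0))"
    by (auto simp: bounded_iff)
  obtain p where p: "\<And>u y n0. \<forall>m\<ge>n0. \<forall>n\<ge>n0. inf \<bar>sup (x m) 0 - sup (x n) 0\<bar> u \<le> y \<Longrightarrow>
      \<forall>n\<ge>n0. inf \<bar>sup (x n) 0 - p\<bar> u \<le> y"
    using sigma_Levi_liminf[OF levi _ bdd(1)] by auto
  obtain q where q: "\<And>u y n0. \<forall>m\<ge>n0. \<forall>n\<ge>n0. inf \<bar>sup (- x m) 0 - sup (- x n) 0\<bar> u \<le> y \<Longrightarrow>
      \<forall>n\<ge>n0. inf \<bar>sup (- x n) 0 - q\<bar> u \<le> y"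
    using sigma_Levi_liminf[OF levi _ bdd(2)] by auto
  have "uo_conv x (p - q)"
    unfolding uo_conv_def
  proof (intro allI impI)
    fix u :: 'a assume u: "0 \<le> u"
    obtain J :: "'a set" and le y where net: "net_decreases_to J le y 0"
      and dom: "\<And>b. b \<in> J \<Longrightarrow> \<exists>n0. \<forall>m\<ge>n0. \<forall>n\<ge>n0. inf \<bar>x m - x n\<bar> u \<le> y b"
      using uo_CauchyD[of x u] x u by blast
    have "\<exists>n0. \<forall>n\<ge>n0. \<bar>inf \<bar>x n - (p - q)\<bar> u - 0\<bar> \<le> 2 *\<^sub>R y b" if b: "b \<in> J" for b
    proof -
      obtain n0 where n0: "\<And>m n. m \<ge> n0 \<Longrightarrow> n \<ge> n0 \<Longrightarrow> inf \<bar>x m - x n\<bar> u \<le> y b"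
        using dom[OF b] by blast
      have "inf \<bar>x n - (p - q)\<bar> u \<le> 2 *\<^sub>R y b" if n: "n \<ge> n0" for n
      proof -
        have "inf \<bar>sup (x m) 0 - sup (x n) 0\<bar> u \<le> y b"
          "inf \<bar>sup (- x m) 0 - sup (- x n) 0\<bar> u \<le> y b" if "m \<ge> n0" "n \<ge> n0" for m n
        proof -
          show "inf \<bar>sup (x m) 0 - sup (x n) 0\<bar> u \<le> y b"
            using n0[OF that] abs_pos_part_diff_le[of "x m" "x n"]
            by (meson inf_mono order_refl order_trans)
          have "\<bar>sup (- x m) 0 - sup (- x n) 0\<bar> \<le> \<bar>x m - x n\<bar>"
            using abs_pos_part_diff_le[of "- x m" "- x n"] by (simp add: abs_minus_commute)
          then show "inf \<bar>sup (- x m) 0 - sup (- x n) 0\<bar> u \<le> y b"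
            using n0[OF that] by (meson inf_mono order_refl order_trans)
        qed
        then have pq: "inf \<bar>sup (x n) 0 - p\<bar> u \<le> y b" "inf \<bar>sup (- x n) 0 - q\<bar> u \<le> y b"
          using p q n by blast+
        have "sup (x n) 0 - sup (- x n) 0 = x n"
          using prts[of "x n"] pprt_neg[of "x n"] by (simp add: pprt_def)
        then have "x n - (p - q) = (sup (x n) 0 - p) - (sup (- x n) 0 - q)"
          by (simp add: algebra_simps)
        then have "\<bar>x n - (p - q)\<bar> \<le> \<bar>sup (x n) 0 - p\<bar> + \<bar>sup (- x n) 0 - q\<bar>"
          by (simp only: abs_triangle_ineq4)
        then have "inf \<bar>x n - (p - q)\<bar> u \<le> inf (\<bar>sup (x n) 0 - p\<bar> + \<bar>sup (- x n) 0 - q\<bar>) u"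
          by (intro inf_mono) simp_all
        also have "\<dots> \<le> inf \<bar>sup (x n) 0 - p\<bar> u + inf \<bar>sup (- x n) 0 - q\<bar> u"
          using u by (intro inf_add_le) simp_all
        also have "\<dots> \<le> y b + y b"
          using pq by (rule add_mono)
        finally show ?thesis by (simp add: scaleR_2)
      qed
      then show ?thesis using u by (auto simp: abs_of_nonneg)
    qed
    moreover have "net_decreases_to J le (\<lambda>b. 2 *\<^sub>R y b) 0"
    proof -
      have "w \<le> 0" if "\<forall>b\<in>J. w \<le> 2 *\<^sub>R y b" for w
      proof -
        have "w /\<^sub>R 2 \<le> 0"
          using that by (intro net_decreases_to_greatestD[OF net]) (simp only: pos_divideR_le_eq zero_less_numeral)
        then show ?thesis by (simp only: pos_divideR_le_eq zero_less_numeral scaleR_zero_right)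
      qed
      then show ?thesis
        using net net_decreases_to_leD[OF net] unfolding net_decreases_to_def isGlb_image_iff
        by (auto intro: scaleR_left_mono scaleR_nonneg_nonneg)
    qed
    ultimately show "order_conv (\<lambda>n. inf \<bar>x n - (p - q)\<bar> u) 0"
      unfolding order_conv_def by blast
  qed
  then show "\<exists>l. uo_conv x l" by blast
qed

section \<open>Increasing sequences that exhaust a ray\<close>

text \<open>
  For an increasing positive sequence \<open>z\<close> this says that \<open>w \<ge> 0\<close> and that \<open>inf (z m) (k w)\<close>
  increases to \<open>k w\<close> for every natural number \<open>k\<close>; intuitively, \<open>z\<close> grows to infinity on the band
  generated by \<open>w\<close>. That \<open>k w\<close> is an upper bound is clear, so only its minimality is required.
\<close>

definition exhausts :: "(nat \<Rightarrow> 'a::banach_lattice) \<Rightarrow> 'a \<Rightarrow> bool" where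
  "exhausts z w \<longleftrightarrow> 0 \<le> w \<and>
     (\<forall>(k::nat) b. (\<forall>m. inf (z m) (real k *\<^sub>R w) \<le> b) \<longrightarrow> real k *\<^sub>R w \<le> b)"

lemma exhaustsD:
  assumes "exhausts z w" "\<And>m. inf (z m) (real k *\<^sub>R w) \<le> b"
  shows "real k *\<^sub>R w \<le> b"
  using assms unfolding exhausts_def by blast

lemma exhausts_scaleR:
  assumes "exhausts z w"
  shows "exhausts z (real j *\<^sub>R w)"
  unfolding exhausts_def
proof (intro conjI allI impI)
  show "0 \<le> real j *\<^sub>R w"
    using assms by (simp add: exhausts_def scaleR_nonneg_nonneg)
  fix k :: nat and b
  assume "\<forall>m. inf (z m) (real k *\<^sub>R real j *\<^sub>R w) \<le> b"
  then have "real (k * j) *\<^sub>R w \<le> b"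
    by (intro exhaustsD[OF assms]) simp
  then show "real k *\<^sub>R real j *\<^sub>R w \<le> b" by simp
qed

text \<open>
  It suffices that, for every \<open>N\<close>, the increments \<open>z m - z N\<close> with \<open>m \<ge> N\<close>, truncated at \<open>w\<close>, have
  supremum \<open>w\<close>: such increments add up to all multiples of \<open>w\<close>.
\<close>

lemma exhaustsI:
  fixes z :: "nat \<Rightarrow> 'a::banach_lattice"
  assumes inc: "incseq z" and pos: "\<And>n. 0 \<le> z n" and w: "0 \<le> w"
    and least: "\<And>N b. (\<And>m. m \<ge> N \<Longrightarrow> inf (z m - z N) w \<le> b) \<Longrightarrow> w \<le> b"
  shows "exhausts z w"
proof -
  have "real k *\<^sub>R w \<le> b" if "\<And>m. inf (z m) (real k *\<^sub>R w) \<le> b" for k :: nat and b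
    using that
  proof (induction k arbitrary: b)
    case 0
    from 0[of 0] pos[of 0] show ?case by (simp add: inf_absorb2)
  next
    case (Suc k)
    have "inf (z N) (real k *\<^sub>R w) \<le> b - w" for N
    proof -
      have "inf (z m - z N) w \<le> b - inf (z N) (real k *\<^sub>R w)" if "m \<ge> N" for m
      proof -
        have "inf (z m - z N) w + inf (z N) (real k *\<^sub>R w) \<le> (z m - z N) + z N"
          by (intro add_mono) simp_all
        moreover have "inf (z m - z N) w + inf (z N) (real k *\<^sub>R w) \<le> w + real k *\<^sub>R w"
          by (intro add_mono) simp_all
        ultimately have "inf (z m - z N) w + inf (z N) (real k *\<^sub>R w) \<le> inf (z m) (real (Suc k) *\<^sub>R w)"
          by (simp add: scaleR_left.add algebra_simps)
        also have "\<dots> \<le> b" by (rule Suc.prems)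
        finally show ?thesis by (simp only: le_diff_eq)
      qed
      then have "w \<le> b - inf (z N) (real k *\<^sub>R w)" by (rule least)
      then show ?thesis by (simp only: le_diff_eq add.commute)
    qed
    then have "real k *\<^sub>R w \<le> b - w" by (rule Suc.IH)
    then show ?case by (simp add: algebra_simps)
  qed
  with w show ?thesis unfolding exhausts_def by blast
qed

text \<open>
  The witness for the Cauchy property at \<open>u\<close> is the set of all eventual upper bounds of the
  truncated differences, directed downwards. A lower bound \<open>v \<ge> 0\<close> of this set is exhausted: if
  \<open>b \<le> v\<close> bounds the differences \<open>z m - z N\<close> with \<open>m \<ge> N\<close> truncated at \<open>v\<close>, subtracting \<open>v - b\<close>
  maps the set into itself, so \<open>v - b \<le> 0\<close> by the Archimedean property.
\<close>

lemma uo_CauchyI_exhausts: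
  fixes z :: "nat \<Rightarrow> 'a::banach_lattice"
  assumes inc: "incseq z" and pos: "\<And>n. 0 \<le> z n"
    and triv: "\<And>w. exhausts z w \<Longrightarrow> w = 0"
  shows "uo_Cauchy z"
  unfolding uo_Cauchy_def uo_conv_def
proof (intro allI impI)
  fix u :: 'a assume u: "0 \<le> u"
  define D where "D = {d. \<exists>N. \<forall>m\<ge>N. inf (z m - z N) u \<le> d}"
  have D_pos: "0 \<le> d" if d: "d \<in> D" for d
  proof -
    obtain N where "\<forall>m\<ge>N. inf (z m - z N) u \<le> d" using d unfolding D_def by blast
    then have "inf (z N - z N) u \<le> d" by blast
    then show ?thesis using u by (simp add: inf_absorb1)
  qed
  have "u \<in> D" by (auto simp: D_def)
  have anti: "inf (z m - z N') v \<le> inf (z m - z N) v" if "N \<le> N'" for m N N' v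
    using incseqD[OF inc that] by (intro inf_mono diff_left_mono) simp_all
  have D_inf: "inf d d' \<in> D" if "d \<in> D" "d' \<in> D" for d d'
  proof -
    obtain N N' where "\<forall>m\<ge>N. inf (z m - z N) u \<le> d" "\<forall>m\<ge>N'. inf (z m - z N') u \<le> d'"
      using \<open>d \<in> D\<close> \<open>d' \<in> D\<close> unfolding D_def by blast
    then have "\<forall>m\<ge>max N N'. inf (z m - z (max N N')) u \<le> inf d d'"
      by (auto intro: order_trans[OF anti[of N "max N N'"]] order_trans[OF anti[of N' "max N N'"]])
    then show ?thesis unfolding D_def by blast
  qed
  have D_lower: "w \<le> 0" if w: "\<And>d. d \<in> D \<Longrightarrow> w \<le> d" for w
  proof -
    define v where "v = sup w 0"
    have v: "0 \<le> v" "\<And>d. d \<in> D \<Longrightarrow> v \<le> d"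
      using w D_pos by (simp_all add: v_def)
    have "exhausts z v"
    proof (rule exhaustsI[OF inc pos v(1)])
      fix N c assume c: "\<And>m. m \<ge> N \<Longrightarrow> inf (z m - z N) v \<le> c"
      define b where "b = inf c v"
      have b: "inf (z m - z N) v \<le> b" if "m \<ge> N" for m
        using c[OF that] by (simp add: b_def)
      have step: "d - (v - b) \<in> D" if d: "d \<in> D" for d
      proof -
        obtain N' where N': "\<And>m. m \<ge> N' \<Longrightarrow> inf (z m - z N') u \<le> d"
          using d unfolding D_def by blast
        define K where "K = max N N'"
        have "inf (z m - z K) u \<le> d - (v - b)" if m: "m \<ge> K" for m
        proof -
          have "inf (z m - z K) u \<le> d"
            using N'[of m] order_trans[OF anti[of N' K m u]] m by (simp add: K_def)
          then have "inf (z m - z K) u \<le> inf (z m - z K) d" by simp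
          also have "\<dots> \<le> inf (z m - z K) v + (d - v)"
            using v(2)[OF \<open>d \<in> D\<close>] by (rule inf_le_inf_add_diff)
          also have "\<dots> \<le> b + (d - v)"
            using b[of m] order_trans[OF anti[of N K m v]] m
            by (intro add_right_mono) (simp add: K_def)
          finally show ?thesis by (simp add: algebra_simps)
        qed
        then show ?thesis unfolding D_def by blast
      qed
      have "u - real k *\<^sub>R (v - b) \<in> D" for k :: nat
      proof (induction k)
        case (Suc k)
        have "u - real (Suc k) *\<^sub>R (v - b) = u - real k *\<^sub>R (v - b) - (v - b)"
          by (simp add: algebra_simps)
        then show ?case using step[OF Suc] by (simp only:)
      qed (simp add: \<open>u \<in> D\<close>)
      then have "real k *\<^sub>R (v - b) \<le> u" for k :: nat
        using D_pos[of "u - real k *\<^sub>R (v - b)"] by simp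
      then have "v - b \<le> 0" by (rule archimedean_le_zero)
      then have "v \<le> b" by simp
      then show "v \<le> c" by (simp add: b_def)
    qed
    then have "v = 0" by (rule triv)
    then show ?thesis by (metis sup_ge1 v_def)
  qed
  have "directed_index D (\<lambda>a b. b \<le> a)"
    unfolding directed_index_def
  proof (intro conjI ballI)
    show "D \<noteq> {}" using \<open>u \<in> D\<close> by blast
    show "reflp_on D (\<lambda>a b. b \<le> a)" by (simp add: reflp_on_def)
    show "transp_on D (\<lambda>a b. b \<le> a)" by (auto simp: transp_on_def)
    fix i j assume "i \<in> D" "j \<in> D"
    then show "\<exists>k\<in>D. k \<le> i \<and> k \<le> j"
      using D_inf[of i j] by (intro bexI[of _ "inf i j"]) simp_all
  qed
  then have "net_decreases_to D (\<lambda>a b. b \<le> a) (\<lambda>d. d) 0"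
    unfolding net_decreases_to_def isGlb_image_iff using D_pos D_lower by auto
  moreover have "\<forall>d\<in>D. \<exists>a0. \<forall>a\<ge>a0. \<bar>inf \<bar>(case a of (m, n) \<Rightarrow> z m - z n) - 0\<bar> u - 0\<bar> \<le> d"
  proof
    fix d assume "d \<in> D"
    then obtain N where N: "\<And>m. m \<ge> N \<Longrightarrow> inf (z m - z N) u \<le> d"
      unfolding D_def by blast
    have "\<bar>inf \<bar>(case a of (m, n) \<Rightarrow> z m - z n) - 0\<bar> u - 0\<bar> \<le> d" if a: "a \<ge> (N, N)" for a
    proof -
      obtain m n where mn: "a = (m, n)" by (cases a)
      then have "m \<ge> N" "n \<ge> N" using a by simp_all
      then have "inf (z m - z n) u \<le> inf (z m - z N) u" "inf (- (z m - z n)) u \<le> inf (z n - z N) u"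
        using anti[of N n m u] anti[of N m n u] by simp_all
      then have "inf \<bar>z m - z n\<bar> u \<le> d"
        unfolding inf_abs_le_iff using N[OF \<open>m \<ge> N\<close>] N[OF \<open>n \<ge> N\<close>] by (meson order_trans)
      then show ?thesis using mn u by (simp add: abs_of_nonneg)
    qed
    then show "\<exists>a0. \<forall>a\<ge>a0. \<bar>inf \<bar>(case a of (m, n) \<Rightarrow> z m - z n) - 0\<bar> u - 0\<bar> \<le> d" by blast
  qed
  ultimately show "order_conv (\<lambda>a. inf \<bar>(case a of (a, b) \<Rightarrow> z a - z b) - 0\<bar> u) 0"
    unfolding order_conv_def by blast
qed

section \<open>Norm bounded increasing sequences\<close>

text \<open>
  Since \<open>x\<close> exhausts \<open>y\<close>, the bands generated by \<open>(y - x m)\<^sup>+\<close> decrease to \<open>{0}\<close>. Only the first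
  \<open>N + 1\<close> terms of a series of multiples of these elements matter on the elements disjoint from
  \<open>(y - x N)\<^sup>+\<close>, so its partial sums cannot exhaust a nonzero element, whatever the coefficients.
\<close>

lemma exhausts_inf_partial_sums:
  fixes x :: "nat \<Rightarrow> 'a::banach_lattice"
  assumes inc: "incseq x" and y: "exhausts x y" and c: "\<And>m. 0 \<le> c m"
    and f_def: "f = (\<lambda>j. \<Sum>m\<le>j. c m *\<^sub>R sup (y - x m) 0)"
    and z: "exhausts (\<lambda>m. inf (x m) (f m)) w" and pos: "\<And>n. 0 \<le> x n"
  shows "w = 0"
proof -
  have y_pos: "0 \<le> y" and w_pos: "0 \<le> w"
    using y z by (simp_all add: exhausts_def)
  define p where "p m = sup (y - x m) 0" for m
  have p_pos: "0 \<le> p m" for m by (simp add: p_def)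
  have p_anti: "p n \<le> p m" if "m \<le> n" for m n
    unfolding p_def using incseqD[OF inc that] by (intro sup_mono diff_left_mono) simp_all
  have p_le: "p m \<le> y" for m
    using pos[of m] y_pos by (simp add: p_def)
  have f: "f j = (\<Sum>m\<le>j. c m *\<^sub>R p m)" for j by (simp add: f_def p_def)
  have f_pos: "0 \<le> f j" for j
    unfolding f by (intro sum_nonneg scaleR_nonneg_nonneg c p_pos)
  \<comment> \<open>The part of \<open>w\<close> below \<open>(x N - y)\<^sup>+\<close> is disjoint from all terms of the sums from \<open>N\<close> on.
    Its multiples are therefore bounded by \<open>f N\<close>, so it is zero.\<close>
  have disj: "inf w (sup (x N - y) 0) = 0" for N
  proof -
    define q where "q = inf w (sup (x N - y) 0)"
    have q: "0 \<le> q" "q \<le> w" by (simp_all add: q_def w_pos)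
    have "inf (p N) q \<le> inf (sup (y - x N) 0) (sup (- (y - x N)) 0)"
      unfolding p_def q_def by (intro inf_mono) simp_all
    also have "\<dots> = 0" by (rule inf_pos_neg_parts)
    finally have pq: "inf (p N) q = 0"
      using p_pos[of N] q by (intro antisym) simp_all
    have "real k *\<^sub>R q \<le> f N" for k :: nat
    proof -
      have kq: "0 \<le> real k *\<^sub>R q" using q by (simp add: scaleR_nonneg_nonneg)
      have f_inf: "inf (f m) (real k *\<^sub>R q) \<le> f N" for m
      proof -
        have sub: "{..m} \<subseteq> {..N} \<union> {N<..m}" by auto
        define C where "C = (\<Sum>i\<in>{N<..m}. c i)"
        have C: "0 \<le> C" unfolding C_def by (intro sum_nonneg c)
        have "f m \<le> (\<Sum>i\<in>{..N} \<union> {N<..m}. c i *\<^sub>R p i)"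
          unfolding f by (intro sum_mono2 sub scaleR_nonneg_nonneg c p_pos) simp
        also have "\<dots> = f N + (\<Sum>i\<in>{N<..m}. c i *\<^sub>R p i)"
          unfolding f by (intro sum.union_disjoint) auto
        also have "(\<Sum>i\<in>{N<..m}. c i *\<^sub>R p i) \<le> (\<Sum>i\<in>{N<..m}. c i *\<^sub>R p N)"
          by (intro sum_mono scaleR_left_mono p_anti c) simp
        also have "\<dots> = C *\<^sub>R p N" by (simp add: C_def scaleR_sum_left)
        finally have "f m \<le> f N + C *\<^sub>R p N" by simp
        then have "inf (f m) (real k *\<^sub>R q) \<le> inf (f N + C *\<^sub>R p N) (real k *\<^sub>R q)"
          by (intro inf_mono) simp_all
        also have "\<dots> \<le> inf (f N) (real k *\<^sub>R q) + inf (C *\<^sub>R p N) (real k *\<^sub>R q)"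
          using f_pos C p_pos kq by (intro inf_add_le) (simp_all add: scaleR_nonneg_nonneg)
        also have "inf (C *\<^sub>R p N) (real k *\<^sub>R q) = 0"
          using p_pos q pq C by (intro inf_scaleR_eq_zero) simp_all
        finally show ?thesis by simp
      qed
      have "real k *\<^sub>R w \<le> f N + (real k *\<^sub>R w - real k *\<^sub>R q)"
      proof (rule exhaustsD[OF z])
        fix m
        have "inf (inf (x m) (f m)) (real k *\<^sub>R w) \<le> inf (f m) (real k *\<^sub>R w)"
          by (intro inf_mono) simp_all
        also have "\<dots> \<le> inf (f m) (real k *\<^sub>R q) + (real k *\<^sub>R w - real k *\<^sub>R q)"
          by (intro inf_le_inf_add_diff scaleR_left_mono q) simp
        also have "\<dots> \<le> f N + (real k *\<^sub>R w - real k *\<^sub>R q)"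
          by (intro add_right_mono f_inf)
        finally show "inf (inf (x m) (f m)) (real k *\<^sub>R w) \<le> f N + (real k *\<^sub>R w - real k *\<^sub>R q)" .
      qed
      then show ?thesis by (simp add: algebra_simps)
    qed
    then have "q \<le> 0" by (rule archimedean_le_zero)
    with q(1) have "q = 0" by (rule antisym[rotated])
    then show ?thesis by (simp only: q_def)
  qed
  \<comment> \<open>Hence \<open>inf (x m) (2 y)\<close> does not exceed \<open>y\<close> on the part of \<open>w\<close> below \<open>y\<close>, yet its supremum is
    \<open>2 y\<close>. So \<open>w\<close> is disjoint from \<open>y\<close>.\<close>
  define v where "v = inf w y"
  have v: "0 \<le> v" "v \<le> w" "v \<le> y" using y_pos w_pos by (simp_all add: v_def)
  have "real 2 *\<^sub>R y \<le> real 2 *\<^sub>R y - v"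
  proof (rule exhaustsD[OF y])
    fix m
    define r where "r = inf (sup (x m - y) 0) y"
    have r: "0 \<le> r" "r \<le> y" using y_pos by (simp_all add: r_def)
    have "inf r v \<le> inf w (sup (x m - y) 0)"
      using v by (auto simp: r_def intro: le_infI1 le_infI2)
    then have "inf r v = 0"
      using disj[of m] r v by (intro antisym) simp_all
    then have "r + v \<le> y"
      using add_eq_inf_sup[of r v] r v by simp
    moreover have "inf (x m) (real 2 *\<^sub>R y) - y \<le> r"
    proof -
      have "inf (x m) (real 2 *\<^sub>R y) - y \<le> x m - y"
        by (intro diff_right_mono) simp
      moreover have "inf (x m) (real 2 *\<^sub>R y) - y \<le> real 2 *\<^sub>R y - y"
        by (intro diff_right_mono) simp
      ultimately show ?thesis by (simp add: r_def scaleR_2 le_supI1)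
    qed
    ultimately have "inf (x m) (real 2 *\<^sub>R y) - y + v \<le> y"
      by (meson add_right_mono order_trans)
    then show "inf (x m) (real 2 *\<^sub>R y) \<le> real 2 *\<^sub>R y - v"
      by (simp add: algebra_simps scaleR_2)
  qed
  then have "v \<le> 0" by simp
  with v(1) have "v = 0" by (rule antisym[rotated])
  then have wy: "inf y w = 0" by (simp add: v_def inf_commute)
  \<comment> \<open>The partial sums lie below multiples of \<open>y\<close>, so they vanish on \<open>w\<close> altogether.\<close>
  have fw: "inf (f m) w = 0" for m
  proof -
    have "f m \<le> (\<Sum>i\<le>m. c i *\<^sub>R y)"
      unfolding f by (intro sum_mono scaleR_left_mono c p_le)
    also have "\<dots> = (\<Sum>i\<le>m. c i) *\<^sub>R y" by (simp add: scaleR_sum_left)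
    finally have "inf (f m) w \<le> inf ((\<Sum>i\<le>m. c i) *\<^sub>R y) (1 *\<^sub>R w)"
      by (intro inf_mono) simp_all
    also have "\<dots> = 0"
      using y_pos w_pos wy by (intro inf_scaleR_eq_zero sum_nonneg c) simp_all
    finally show ?thesis using f_pos w_pos by (intro antisym) simp_all
  qed
  have "real 1 *\<^sub>R w \<le> 0"
  proof (rule exhaustsD[OF z])
    fix m
    show "inf (inf (x m) (f m)) (real 1 *\<^sub>R w) \<le> 0"
      using fw[of m] by (simp add: inf_assoc)
  qed
  with w_pos show ?thesis by simp
qed

text \<open>
  With coefficients that make the partial sums \<open>f m\<close> unbounded in norm, \<open>inf (x m) (f m)\<close> is a
  norm bounded increasing uo-Cauchy sequence. Every upper bound of it dominates each \<open>f m\<close>,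
  because \<open>x\<close> exhausts the ray of \<open>y\<close>.
\<close>

lemma bounded_incseq_not_exhausts:
  fixes x :: "nat \<Rightarrow> 'a::banach_lattice"
  assumes complete: "\<And>z :: nat \<Rightarrow> 'a. (\<forall>n. 0 \<le> z n) \<Longrightarrow> incseq z \<Longrightarrow> bounded (range z) \<Longrightarrow>
      uo_Cauchy z \<Longrightarrow> \<exists>s. isLub UNIV (range z) s"
    and pos: "\<And>n. 0 \<le> x n" and inc: "incseq x" and bdd: "bounded (range x)"
    and y': "exhausts x y'"
  shows "y' = 0"
proof (rule ccontr)
  assume "y' \<noteq> 0"
  obtain M where M: "\<And>n. norm (x n) \<le> M"
    using bdd by (auto simp: bounded_iff)
  \<comment> \<open>A large multiple of the exhausted element lies below no \<open>x m\<close>, by the norm bound.\<close>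
  obtain k :: nat where k: "M < real k * norm y'"
    using reals_Archimedean3[of "norm y'"] \<open>y' \<noteq> 0\<close> by auto
  define y where "y = real k *\<^sub>R y'"
  have y: "exhausts x y" unfolding y_def using y' by (rule exhausts_scaleR)
  have y_pos: "0 \<le> y" using y by (simp add: exhausts_def)
  have "\<not> y \<le> x m" for m
    using norm_mono_nonneg[OF y_pos, of "x m"] M[of m] k by (auto simp: y_def)
  define p where "p m = sup (y - x m) 0" for m
  have p_pos: "0 \<le> p m" for m by (simp add: p_def)
  have p_nz: "p m \<noteq> 0" for m
    using \<open>\<not> y \<le> x m\<close> by (metis diff_le_0_iff_le p_def sup_ge1)
  define c where "c m = real m / norm (p m)" for m
  have c: "0 \<le> c m" for m by (simp add: c_def)
  define f where "f = (\<lambda>j. \<Sum>m\<le>j. c m *\<^sub>R sup (y - x m) 0)"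
  have f: "f j = (\<Sum>m\<le>j. c m *\<^sub>R p m)" for j by (simp add: f_def p_def)
  have f_inc: "incseq f"
    by (rule incseq_SucI) (simp add: f c p_pos scaleR_nonneg_nonneg)
  have f_pos: "0 \<le> f j" for j
    unfolding f by (intro sum_nonneg scaleR_nonneg_nonneg c p_pos)
  have f_norm: "real j \<le> norm (f j)" for j
  proof -
    have "c j *\<^sub>R p j \<le> f j"
      unfolding f by (subst sum.remove[of _ j]) (simp_all add: sum_nonneg c p_pos scaleR_nonneg_nonneg)
    then have "norm (c j *\<^sub>R p j) \<le> norm (f j)"
      by (intro norm_mono_nonneg scaleR_nonneg_nonneg c p_pos)
    then show ?thesis using p_nz[of j] by (simp add: c_def)
  qed
  define z where "z = (\<lambda>m. inf (x m) (f m))"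
  have z_pos: "0 \<le> z n" for n by (simp add: z_def pos f_pos)
  have z_inc: "incseq z"
    unfolding z_def using inc f_inc by (auto simp: incseq_def intro: le_infI1 le_infI2)
  have "norm (z n) \<le> M" for n
  proof -
    have "norm (z n) \<le> norm (x n)"
      using z_pos by (rule norm_mono_nonneg) (simp add: z_def)
    then show ?thesis using M[of n] by simp
  qed
  then have z_bdd: "bounded (range z)" by (auto simp: bounded_iff)
  have "uo_Cauchy z"
  proof (rule uo_CauchyI_exhausts[OF z_inc z_pos])
    fix w assume "exhausts z w"
    then show "w = 0"
      unfolding z_def using exhausts_inf_partial_sums[OF inc y c f_def _ pos] by blast
  qed
  then obtain s where "isLub UNIV (range z) s"
    using complete[OF _ z_inc z_bdd] z_pos by blast
  then have s: "\<And>n. z n \<le> s" by (simp add: isLub_range_iff)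
  have f_le: "f j \<le> s" for j
  proof -
    have "f j \<le> (\<Sum>i\<le>j. c i *\<^sub>R y)"
      unfolding f using pos y_pos by (intro sum_mono scaleR_left_mono c) (simp add: p_def)
    also have "\<dots> = (\<Sum>i\<le>j. c i) *\<^sub>R y" by (simp add: scaleR_sum_left)
    also have "\<dots> \<le> real (nat \<lceil>\<Sum>i\<le>j. c i\<rceil>) *\<^sub>R y"
      using y_pos by (intro scaleR_right_mono) (simp_all add: real_nat_ceiling_ge)
    finally obtain n :: nat where n: "f j \<le> real n *\<^sub>R y" by blast
    have "real n *\<^sub>R y \<le> s + (real n *\<^sub>R y - f j)"
    proof (rule exhaustsD[OF y])
      fix m
      have "inf (x m) (f j) \<le> z (max m j)"
        unfolding z_def using incseqD[OF inc, of m "max m j"] incseqD[OF f_inc, of j "max m j"]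
        by (intro inf_mono) simp_all
      also have "\<dots> \<le> s" by (rule s)
      finally have "inf (x m) (f j) + (real n *\<^sub>R y - f j) \<le> s + (real n *\<^sub>R y - f j)"
        by (rule add_right_mono)
      with inf_le_inf_add_diff[OF n] show "inf (x m) (real n *\<^sub>R y) \<le> s + (real n *\<^sub>R y - f j)"
        by (rule order_trans)
    qed
    then show ?thesis by (simp add: algebra_simps)
  qed
  have "real j \<le> norm s" for j :: nat
    using f_norm[of j] norm_mono_nonneg[OF f_pos f_le, of j] by simp
  then show False
    using reals_Archimedean2[of "norm s"] by (meson not_le)
qed

section \<open>The equivalence\<close>

theorem theorem2p5:
  shows "(sigma_Levi TYPE('a::banach_lattice) \<longleftrightarrow> sequentially_boundedly_uo_complete TYPE('a))
    \<and> (sequentially_boundedly_uo_complete TYPE('a) \<longleftrightarrow>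
        (\<forall>x :: nat \<Rightarrow> 'a. (\<forall>n. 0 \<le> x n) \<and> incseq x \<and> bounded (range x) \<and> uo_Cauchy x \<longrightarrow>
           (\<exists>s. isLub UNIV (range x) s)))"
    (is "(?i \<longleftrightarrow> ?ii) \<and> (?ii \<longleftrightarrow> ?iii)")
proof -
  have "?ii" if "?i"
    using that by (rule sigma_Levi_imp_uo_complete)
  moreover have "?iii" if "?ii"
    using that incseq_uo_conv_isLub unfolding sequentially_boundedly_uo_complete_def by blast
  \<comment> \<open>Under (iii), every norm bounded increasing sequence of positive elements is uo-Cauchy.\<close>
  moreover have "?i" if iii: "?iii"
    unfolding sigma_Levi_def
  proof (intro allI impI)
    fix x :: "nat \<Rightarrow> 'a"
    assume x: "(\<forall>n. 0 \<le> x n) \<and> incseq x \<and> bounded (range x)"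
    then have "w = 0" if "exhausts x w" for w
      using bounded_incseq_not_exhausts[of x w] iii that by blast
    then have "uo_Cauchy x"
      using x by (intro uo_CauchyI_exhausts) auto
    with x iii show "\<exists>s. isLub UNIV (range x) s" by blast
  qed
  ultimately show ?thesis by blast
qed

end
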